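(* Let $0\le k<\ell$ be real numbers and let $n$ be a positive integer. Let $\mathbf{v}\in \mathbb{R}_{>0}^n$ be a weight vector. Let $r$ be the least real number such that $m(\mathbf{v},r)\ge 2(\ell-k)$ and $r\ge1$. Then $$\dim(\mathcal{M}_{[k,\ell]}^{n,\mathbf{v}})\le 43r^2\log n.$$
   Context: $\log$ denotes the natural logarithm, and $[n]=\{1,\dots,n\}$. For a multiset $S$ of elements of $[n]$, let $\mathbf{x}(S)\in\mathbb{Z}_{\ge0}^n$ be its tuple of multiplicities. $\mathcal{M}^n$ is the (infinite) poset of all multisets of elements of $[n]$ (with finite multiplicities) ordered by inclusion: $S\subseteq T$ iff each element has multiplicity in $S$ at most its multiplicity in $T$ (so $\mathcal{M}^n\cong\mathbb{Z}_{\ge0}^n$ with the coordinatewise order). For a weight vector $\mathbf{v}\in\mathbb{R}_{>0}^n$, the $\mathbf{v}$-size of $S$ is $|S|_{\mathbf{v}}=\mathbf{x}(S)\cdot\mathbf{v}$ (dot product), and $\mathcal{M}_{[k,\ell]}^{n,\mathbf{v}}$ is the suborder of $\mathcal{M}^n$ on the multisets $S$ with $|S|_{\mathbf{v}}\in[k,\ell]$. For a vector $\mathbf{v}\in\mathbb{R}_{>0}^n$ and a real $s$, $m(\mathbf{v},s)$ denotes the sum of the least $\lfloor s\rfloor$ coordinates of $\mathbf{v}$. The Dushnik–Miller dimension $\dim(P)$ of a finite poset $P$ is the least $d\in\mathbb{N}$ such that $P$ embeds (is order-isomorphic to a suborder) into a product of $d$ chains (linear orders), where a product of posets carries the coordinatewise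 order. *)

theory Defs
  imports Complex_Main "HOL-Library.Multiset" "HOL-Library.FuncSet"
begin

text \<open>A poset is a carrier \<open>A\<close> with a relation \<open>r\<close> such that \<open>partial_order_on A r\<close>; a chain is a
  carrier \<open>C\<close> with a relation \<open>R\<close> such that \<open>linear_order_on C R\<close>.\<close>

definition order_embedding :: "'a set \<Rightarrow> 'a rel \<Rightarrow> 'b set \<Rightarrow> 'b rel \<Rightarrow> ('a \<Rightarrow> 'b) \<Rightarrow> bool" where
  "order_embedding A r B s f \<longleftrightarrow>
     f \<in> A \<rightarrow> B \<and> inj_on f A \<and> (\<forall>x\<in>A. \<forall>y\<in>A. (x, y) \<in> r \<longleftrightarrow> (f x, f y) \<in> s)"

definition product_order :: "'i set \<Rightarrow> ('i \<Rightarrow> 'c set) \<Rightarrow> ('i \<Rightarrow> 'c rel) \<Rightarrow> ('i \<Rightarrow> 'c) rel" where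
  "product_order I C R = relation_of (\<lambda>x y. \<forall>i\<in>I. (x i, y i) \<in> R i) (Pi\<^sub>E I C)"

text \<open>The chains below live on arbitrary subsets of the type of the elements of the poset. This
  loses no generality: by \<open>embeds_in_chainsI\<close>, chains over any other type can be replaced by
  such chains.\<close>

definition embeds_in_chains :: "'a set \<Rightarrow> 'a rel \<Rightarrow> nat \<Rightarrow> bool" where
  "embeds_in_chains A r d \<longleftrightarrow>
     (\<exists>(C :: nat \<Rightarrow> 'a set) R f. (\<forall>i<d. linear_order_on (C i) (R i)) \<and>
        order_embedding A r (Pi\<^sub>E {..<d} C) (product_order {..<d} C R) f)"

text \<open>The Dushnik--Miller dimension. The product of no chains is a single point, so posets with
  at most one element have dimension 0. For a finite poset the minimum is attained, see
  \<open>finite_embeds_in_chains\<close>.\<close>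

definition poset_dim :: "'a set \<Rightarrow> 'a rel \<Rightarrow> nat" where
  "poset_dim A r = (LEAST d. embeds_in_chains A r d)"

text \<open>Multisets of elements of \<open>{1..n}\<close>; the tuple of multiplicities of \<open>S\<close> is \<open>count S\<close>, and
  a vector in \<open>\<real>\<^sup>n\<close> is a function of which only the values on \<open>{1..n}\<close> are used.\<close>

definition wsize :: "nat \<Rightarrow> (nat \<Rightarrow> real) \<Rightarrow> nat multiset \<Rightarrow> real" where
  "wsize n v S = (\<Sum>i = 1..n. real (count S i) * v i)"

definition mset_layers :: "nat \<Rightarrow> (nat \<Rightarrow> real) \<Rightarrow> real \<Rightarrow> real \<Rightarrow> nat multiset set" where
  "mset_layers n v k l = {S. set_mset S \<subseteq> {1..n} \<and> wsize n v S \<in> {k..l}}"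

definition mset_layers_order :: "nat \<Rightarrow> (nat \<Rightarrow> real) \<Rightarrow> real \<Rightarrow> real \<Rightarrow> nat multiset rel" where
  "mset_layers_order n v k l = relation_of (\<subseteq>#) (mset_layers n v k l)"

text \<open>If \<open>\<lfloor>s\<rfloor> > n\<close>, this is the sum of all the coordinates.\<close>

definition least_sum :: "nat \<Rightarrow> (nat \<Rightarrow> real) \<Rightarrow> real \<Rightarrow> real" where
  "least_sum n v s = sum_list (take (nat \<lfloor>s\<rfloor>) (sort (map v [1..<n+1])))"

lemma embeds_in_chainsI:
  fixes C :: "nat \<Rightarrow> 'c set" and A :: "'a set"
  assumes lin: "\<And>i. i < d \<Longrightarrow> linear_order_on (C i) (R i)"
    and emb: "order_embedding A r (Pi\<^sub>E {..<d} C) (product_order {..<d} C R) f"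
  shows "embeds_in_chains A r d"
proof -
  define h where "h i = inv_into A (\<lambda>x. f x i)" for i
  define C' where "C' i = {x \<in> A. h i (f x i) = x}" for i
  define R' where "R' i = {(x, y). x \<in> C' i \<and> y \<in> C' i \<and> (f x i, f y i) \<in> R i}" for i
  define g where "g x = (\<lambda>i\<in>{..<d}. h i (f x i))" for x
  have fC: "f x i \<in> C i" if "x \<in> A" "i < d" for x i
    using emb that by (auto simp: order_embedding_def PiE_iff)
  have hA: "h i (f x i) \<in> A" if "x \<in> A" for x i
    unfolding h_def using that by (intro inv_into_into) auto
  have fh: "f (h i (f x i)) i = f x i" if "x \<in> A" for x i
    unfolding h_def using that by (intro f_inv_into_f[of _ "\<lambda>x. f x i" A]) auto
  have hC: "h i (f x i) \<in> C' i" if "x \<in> A" for x i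
    using hA[OF that] fh[OF that] by (simp add: C'_def)
  have "linear_order_on (C' i) (R' i)" if i: "i < d" for i
  proof -
    have sub: "C' i \<subseteq> A" by (auto simp: C'_def)
    have l: "R i \<subseteq> C i \<times> C i" "refl_on (C i) (R i)" "trans (R i)" "antisym (R i)"
      "total_on (C i) (R i)"
      using lin[OF i] by (auto simp: order_on_defs)
    have eq: "x = y" if "x \<in> C' i" "y \<in> C' i" "f x i = f y i" for x y
      using that by (metis (mono_tags, lifting) C'_def mem_Collect_eq)
    show ?thesis
      unfolding order_on_defs
    proof (intro conjI)
      show "refl_on (C' i) (R' i)"
        using l(2) fC[OF _ i] sub by (auto simp: refl_on_def R'_def)
      show "trans (R' i)"
        using l(3) by (auto simp: trans_def R'_def)
      show "antisym (R' i)"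
        using l(4) eq by (auto simp: antisym_def R'_def)
      show "total_on (C' i) (R' i)"
        using l(5) fC[OF _ i] sub eq unfolding total_on_def R'_def by blast
    qed (auto simp: R'_def)
  qed
  moreover have "order_embedding A r (Pi\<^sub>E {..<d} C') (product_order {..<d} C' R') g"
  proof -
    have gC: "g x \<in> Pi\<^sub>E {..<d} C'" if "x \<in> A" for x
      using hC[OF that] by (auto simp: g_def)
    have finj: "inj_on f A" and fP: "\<And>x. x \<in> A \<Longrightarrow> f x \<in> Pi\<^sub>E {..<d} C"
      using emb by (auto simp: order_embedding_def)
    have "inj_on g A"
    proof (rule inj_onI)
      fix x y assume xy: "x \<in> A" "y \<in> A" "g x = g y"
      have "f x i = f y i" if "i < d" for i
      proof -
      have "h i (f x i) = h i (f y i)"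
        using fun_cong[OF xy(3), of i] that by (simp add: g_def)
      then show ?thesis using fh xy(1,2) by metis
    qed
      then have "f x = f y"
        using fP[OF xy(1)] fP[OF xy(2)] by (intro PiE_ext) auto
      then show "x = y" using finj xy by (auto dest: inj_onD)
    qed
    moreover have "(g x, g y) \<in> product_order {..<d} C' R' \<longleftrightarrow>
        (f x, f y) \<in> product_order {..<d} C R" if "x \<in> A" "y \<in> A" for x y
    proof -
      have "(h i (f x i), h i (f y i)) \<in> R' i \<longleftrightarrow> (f x i, f y i) \<in> R i" for i
        unfolding R'_def using fh hC that by simp
      then show ?thesis
        using gC[OF that(1)] gC[OF that(2)] fP[OF that(1)] fP[OF that(2)]
        by (simp add: product_order_def relation_of_def g_def)
    qed
    ultimately show ?thesis
      using emb gC by (auto simp: order_embedding_def)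
  qed
  ultimately show ?thesis
    unfolding embeds_in_chains_def by blast
qed

lemma finite_embeds_in_chains:
  fixes A :: "'a set"
  assumes "finite A" and "partial_order_on A r"
  shows "\<exists>d. embeds_in_chains A r d"
proof -
  define d where "d = card A"
  obtain p where p: "bij_betw p {..<d} A"
    using ex_bij_betw_nat_finite[OF assms(1)] by (auto simp: d_def atLeast0LessThan)
  define C where "C = (\<lambda>_::nat. UNIV :: bool set)"
  define R where "R = (\<lambda>_::nat. {(a, b). a \<le> (b::bool)})"
  define f where "f x = (\<lambda>i\<in>{..<d}. (x, p i) \<notin> r)" for x
  have r: "r \<subseteq> A \<times> A" "refl_on A r" "trans r" "antisym r"
    using assms(2) by (auto simp: order_on_defs)
  have key: "(x, y) \<in> r \<longleftrightarrow> (\<forall>i<d. (y, p i) \<in> r \<longrightarrow> (x, p i) \<in> r)" if "x \<in> A" "y \<in> A" for x y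
  proof
    assume "\<forall>i<d. (y, p i) \<in> r \<longrightarrow> (x, p i) \<in> r"
    moreover obtain i where "i < d" "p i = y"
      using p \<open>y \<in> A\<close> by (auto simp: bij_betw_def)
    ultimately show "(x, y) \<in> r" using r(2) \<open>y \<in> A\<close> by (auto simp: refl_on_def)
  qed (use r(3) in \<open>auto dest: transD\<close>)
  have "order_embedding A r (Pi\<^sub>E {..<d} C) (product_order {..<d} C R) f"
    unfolding order_embedding_def
  proof (intro conjI ballI inj_onI)
    fix x y assume xy: "x \<in> A" "y \<in> A"
    show "(x, y) \<in> r \<longleftrightarrow> (f x, f y) \<in> product_order {..<d} C R"
      using key[OF xy] by (auto simp: product_order_def relation_of_def C_def R_def f_def)
  next
    fix x y assume xy: "x \<in> A" "y \<in> A" "f x = f y"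
    have "(x, p i) \<in> r \<longleftrightarrow> (y, p i) \<in> r" if "i < d" for i
      using fun_cong[OF xy(3), of i] that by (auto simp: f_def)
    then have "(x, y) \<in> r" "(y, x) \<in> r" using key xy by auto
    then show "x = y" using r(4) by (auto dest: antisymD)
  qed (auto simp: f_def C_def)
  moreover have "linear_order_on (C i) (R i)" for i
    by (auto simp: order_on_defs C_def R_def refl_on_def trans_def antisym_def total_on_def)
  ultimately show ?thesis by (blast intro: embeds_in_chainsI)
qed

lemma partial_order_on_mset_layers:
  "partial_order_on (mset_layers n v k l) (mset_layers_order n v k l)"
  by (auto simp: mset_layers_order_def relation_of_def order_on_defs refl_on_def trans_def
      antisym_def intro: subset_mset.order_trans subset_mset.antisym)

lemma finite_mset_layers:
  assumes "\<forall>i\<in>{1..n}. 0 < v i"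
  shows "finite (mset_layers n v k l)"
proof (rule finite_subset)
  define b where "b i = nat \<lceil>l / v i\<rceil>" for i
  have le: "count S i \<le> b i" if S: "S \<in> mset_layers n v k l" and i: "i \<in> {1..n}" for S i
  proof -
    have "real (count S i) * v i \<le> wsize n v S"
      unfolding wsize_def using assms i
      by (intro member_le_sum[of i "{1..n}" "\<lambda>i. real (count S i) * v i"])
        (auto intro!: mult_nonneg_nonneg intro: order.strict_implies_order)
    also have "\<dots> \<le> l" using S by (simp add: mset_layers_def)
    finally have "real (count S i) \<le> l / v i" using assms i by (simp add: pos_le_divide_eq)
    then show ?thesis unfolding b_def by linarith
  qed
  show "mset_layers n v k l \<subseteq> (\<lambda>g. Abs_multiset (\<lambda>i. if i \<in> {1..n} then g i else 0)) `
      (\<Pi>\<^sub>E i\<in>{1..n}. {..b i})"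
  proof
    fix S assume S: "S \<in> mset_layers n v k l"
    then have "count S i = 0" if "i \<notin> {1..n}" for i
      using that by (auto simp: mset_layers_def count_eq_zero_iff)
    then have "(\<lambda>i. if i \<in> {1..n} then restrict (count S) {1..n} i else 0) = count S"
      by (auto simp: fun_eq_iff)
    then have "S = Abs_multiset (\<lambda>i. if i \<in> {1..n} then restrict (count S) {1..n} i else 0)"
      by (simp add: count_inverse)
    moreover have "restrict (count S) {1..n} \<in> (\<Pi>\<^sub>E i\<in>{1..n}. {..b i})"
      using le[OF S] by auto
    ultimately show "S \<in> (\<lambda>g. Abs_multiset (\<lambda>i. if i \<in> {1..n} then g i else 0)) `
        (\<Pi>\<^sub>E i\<in>{1..n}. {..b i})"
      by (rule image_eqI)
  qed
qed (auto intro!: finite_PiE)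

end

theory Submission
  imports Defs "HOL-Analysis.Harmonic_Numbers"
begin

text \<open>Colour \<open>{1..n}\<close> with \<open>q \<approx> 9 r / 2\<close> colours. For a colour class \<open>X\<close>, four monotone maps on the
  restrictions of the multisets to \<open>X\<close> reverse every pair \<open>S\<close>, \<open>T\<close> that differs on \<open>X\<close> and in
  which \<open>T\<close> exceeds \<open>S\<close> on \<open>X\<close> by at most half the least weight of \<open>X\<close>. If no class of a colouring
  does this for a given pair, then the definition of \<open>r\<close> forces \<open>S\<close> and \<open>T\<close> to differ on fewer
  than \<open>r\<close> classes. So it suffices to have colourings such that every set of \<open>s \<approx> 3 r / 2\<close>
  elements sees \<open>r\<close> colours in one of them (this settles the pairs that differ in at least \<open>s\<close>
  elements), and every element is isolated by one of them from any \<open>s - 1\<close> others (this settles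
  the remaining pairs, by isolating an element whose multiplicity in \<open>S\<close> is larger). A random
  colouring meets either requirement with probability at least \<open>1/2\<close>, so about \<open>s log\<^sub>2 n\<close> colourings,
  chosen greedily, are enough.\<close>

section \<open>Dimension via monotone maps into chains\<close>

text \<open>The tuple of all \<open>F i\<close> is an embedding: monotonicity gives one direction,
  the reversal of each pair outside \<open>r\<close> the other, and antisymmetry then gives
  injectivity. So the dimension is bounded by counting monotone maps, none of which has to be
  injective.\<close>

lemma poset_dim_le_card:
  fixes F :: "'i \<Rightarrow> 'a \<Rightarrow> 'c::linorder"
  assumes po: "partial_order_on A r" and I: "finite I" "card I \<le> d"
    and mono: "\<And>i x y. i \<in> I \<Longrightarrow> (x, y) \<in> r \<Longrightarrow> F i x \<le> F i y"
    and sep: "\<And>x y. x \<in> A \<Longrightarrow> y \<in> A \<Longrightarrow> (x, y) \<notin> r \<Longrightarrow> \<exists>i\<in>I. F i y < F i x"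
  shows "poset_dim A r \<le> d"
proof -
  obtain e where e: "bij_betw e {..<card I} I"
    using ex_bij_betw_nat_finite[OF I(1)] by (auto simp: atLeast0LessThan)
  define f where "f x = (\<lambda>i\<in>{..<card I}. F (e i) x)" for x
  have key: "(x, y) \<in> r \<longleftrightarrow> (\<forall>i<card I. F (e i) x \<le> F (e i) y)" if xy: "x \<in> A" "y \<in> A" for x y
  proof
    assume "(x, y) \<in> r"
    then show "\<forall>i<card I. F (e i) x \<le> F (e i) y"
      using e by (auto simp: bij_betw_def intro!: mono)
  next
    assume le: "\<forall>i<card I. F (e i) x \<le> F (e i) y"
    show "(x, y) \<in> r"
    proof (rule ccontr)
      assume "(x, y) \<notin> r"
      then obtain i where i: "i \<in> I" "F i y < F i x" using sep[OF xy] by blast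
      then have "i \<in> e ` {..<card I}" using bij_betw_imp_surj_on[OF e] by simp
      with i(2) le show False by (auto simp: not_le[symmetric])
    qed
  qed
  have r: "refl_on A r" "antisym r"
    using po by (auto simp: order_on_defs)
  have "embeds_in_chains A r (card I)"
  proof (rule embeds_in_chainsI)
    show "linear_order_on UNIV {(a, b). a \<le> (b :: 'c)}" for i :: nat
      by (auto simp: order_on_defs refl_on_def trans_def antisym_def total_on_def)
    show "order_embedding A r (Pi\<^sub>E {..<card I} (\<lambda>_. UNIV))
        (product_order {..<card I} (\<lambda>_. UNIV) (\<lambda>_. {(a, b). a \<le> (b :: 'c)})) f"
      unfolding order_embedding_def
    proof (intro conjI ballI inj_onI)
      fix x y assume "x \<in> A" "y \<in> A"
      then show "(x, y) \<in> r \<longleftrightarrow> (f x, f y) \<in>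
          product_order {..<card I} (\<lambda>_. UNIV) (\<lambda>_. {(a, b). a \<le> (b :: 'c)})"
        using key by (auto simp: product_order_def relation_of_def f_def)
    next
      fix x y assume xy: "x \<in> A" "y \<in> A" "f x = f y"
      have "F (e i) x = F (e i) y" if "i < card I" for i
        using fun_cong[OF xy(3), of i] that by (simp add: f_def)
      then have "(x, y) \<in> r" "(y, x) \<in> r" using key xy by auto
      then show "x = y" using r(2) by (auto dest: antisymD)
    qed (auto simp: f_def)
  qed
  then show ?thesis
    unfolding poset_dim_def using I(2) Least_le order_trans by blast
qed

section \<open>Separation on a colour class\<close>

text \<open>Two submultisets of the class \<open>X\<close> in the same bucket, of width \<open>w\<close>, are incomparable as
  soon as all the weights on \<open>X\<close> are at least \<open>w\<close>, so inside a bucket any linear order may be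
  used: both \<open>c\<close> and its reverse. The bucket boundaries are shifted by \<open>h\<close>.\<close>

definition class_rank ::
  "('a \<Rightarrow> real) \<Rightarrow> real \<Rightarrow> ('a multiset \<Rightarrow> nat) \<Rightarrow> 'a set \<Rightarrow> real \<Rightarrow> real \<Rightarrow> 'a multiset \<Rightarrow> real" where
  "class_rank v w c X h e S =
     of_int \<lfloor>(\<Sum>i\<in>X. real (count S i) * v i) / w + h\<rfloor>
     + e / (real (c (filter_mset (\<lambda>i. i \<in> X) S)) + 3)"

lemma filter_mset_mem_eq_iff:
  "filter_mset (\<lambda>i. i \<in> X) S = filter_mset (\<lambda>i. i \<in> X) T \<longleftrightarrow> (\<forall>i\<in>X. count S i = count T i)"
  by (auto simp: multiset_eq_iff)

text \<open>The tie-breaking terms have absolute value at most 1/3 because of the summand 3, so two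
  of them differ by at most 2/3 and cannot outweigh a step between integers.\<close>

lemma floor_plus_frac_less:
  fixes a b :: real and m m' :: nat
  assumes "\<lfloor>a\<rfloor> < \<lfloor>b\<rfloor>" and "\<bar>e\<bar> \<le> 1"
  shows "of_int \<lfloor>a\<rfloor> + e / (real m + 3) < of_int \<lfloor>b\<rfloor> + e / (real m' + 3)"
proof -
  have "\<bar>e / (real m + 3)\<bar> \<le> 1 / 3" for m :: nat
    unfolding abs_divide using assms(2) by (intro frac_le) auto
  from this[of m] this[of m'] have "e / (real m + 3) - e / (real m' + 3) < 1"
    by linarith
  moreover have "real_of_int \<lfloor>a\<rfloor> + 1 \<le> of_int \<lfloor>b\<rfloor>" using assms(1) by linarith
  ultimately show ?thesis by linarith
qed

text \<open>If \<open>S\<close> and \<open>T\<close> agree on \<open>X\<close>, the ranks coincide.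
  Otherwise some multiplicity on \<open>X\<close> grows by at least 1, the weight grows by at least
  \<open>w\<close>, and the bucket number strictly increases whatever the shift.\<close>

lemma class_rank_mono:
  assumes "finite X" and w: "0 < w" "\<And>i. i \<in> X \<Longrightarrow> w \<le> v i" and e: "\<bar>e\<bar> \<le> 1" and ST: "S \<subseteq># T"
  shows "class_rank v w c X h e S \<le> class_rank v w c X h e T"
proof (cases "\<forall>i\<in>X. count S i = count T i")
  case True
  then have "filter_mset (\<lambda>i. i \<in> X) S = filter_mset (\<lambda>i. i \<in> X) T"
    by (simp add: filter_mset_mem_eq_iff)
  with True show ?thesis by (simp add: class_rank_def)
next
  case False
  then obtain j where j: "j \<in> X" "count S j \<noteq> count T j" by auto
  have le: "count S i \<le> count T i" for i using ST by (simp add: mset_subset_eq_count)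
  have "1 \<le> real (count T j) - real (count S j)" using le[of j] j(2) by linarith
  then have "1 * w \<le> (real (count T j) - real (count S j)) * v j"
    using w j(1) by (intro mult_mono) auto
  then have "w \<le> (real (count T j) - real (count S j)) * v j" by simp
  also have "\<dots> \<le> (\<Sum>i\<in>X. (real (count T i) - real (count S i)) * v i)"
    using le w \<open>finite X\<close> j(1)
    by (intro member_le_sum[of j X "\<lambda>i. (real (count T i) - real (count S i)) * v i"])
      (auto intro!: mult_nonneg_nonneg intro: order_trans[OF less_imp_le])
  finally have "w + (\<Sum>i\<in>X. real (count S i) * v i) \<le> (\<Sum>i\<in>X. real (count T i) * v i)"
    by (simp add: left_diff_distrib sum_subtractf)
  then have "(w + (\<Sum>i\<in>X. real (count S i) * v i)) / w \<le> (\<Sum>i\<in>X. real (count T i) * v i) / w"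
    using w(1) by (intro divide_right_mono) auto
  then have "(\<Sum>i\<in>X. real (count S i) * v i) / w + h + 1 \<le> (\<Sum>i\<in>X. real (count T i) * v i) / w + h"
    using w(1) by (simp add: add_divide_distrib)
  then have "\<lfloor>(\<Sum>i\<in>X. real (count S i) * v i) / w + h\<rfloor> < \<lfloor>(\<Sum>i\<in>X. real (count T i) * v i) / w + h\<rfloor>"
    by linarith
  then show ?thesis
    unfolding class_rank_def by (intro less_imp_le floor_plus_frac_less e)
qed

lemma class_rank_separates:
  assumes w: "0 < w" and diff: "\<exists>i\<in>X. count S i \<noteq> count T i"
    and inj: "inj_on c {filter_mset (\<lambda>i. i \<in> X) S, filter_mset (\<lambda>i. i \<in> X) T}"
    and D: "(\<Sum>i\<in>X. real (count T i) * v i) \<le> (\<Sum>i\<in>X. real (count S i) * v i) + w / 2"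
  shows "\<exists>h\<in>{0, 1/2}. \<exists>e\<in>{1, -1}. class_rank v w c X h e T < class_rank v w c X h e S"
proof -
  define a where "a = (\<Sum>i\<in>X. real (count S i) * v i) / w"
  define b where "b = (\<Sum>i\<in>X. real (count T i) * v i) / w"
  define m where "m = c (filter_mset (\<lambda>i. i \<in> X) S)"
  define m' where "m' = c (filter_mset (\<lambda>i. i \<in> X) T)"
  have rank: "class_rank v w c X h e S = of_int \<lfloor>a + h\<rfloor> + e / (real m + 3)"
    "class_rank v w c X h e T = of_int \<lfloor>b + h\<rfloor> + e / (real m' + 3)" for h e
    by (simp_all add: class_rank_def a_def b_def m_def m'_def)
  have "m \<noteq> m'"
    using inj diff by (auto simp: m_def m'_def inj_on_eq_iff filter_mset_mem_eq_iff)
  have "b \<le> a + 1 / 2" using D w by (simp add: a_def b_def field_simps)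
  \<comment> \<open>If the bucket number rose under both shifts, the half-open interval from
    \<open>a\<close> to \<open>b\<close>, of length at most 1/2, would contain both an integer
    \<open>p\<close> and a half-integer \<open>q - 1/2\<close>. These are at least 1/2
    apart.\<close>
  have "\<lfloor>b + 0\<rfloor> \<le> \<lfloor>a + 0\<rfloor> \<or> \<lfloor>b + 1/2\<rfloor> \<le> \<lfloor>a + 1/2\<rfloor>"
  proof (rule ccontr)
    assume "\<not> ?thesis"
    then have lt: "a < of_int \<lfloor>b\<rfloor>" "a + 1/2 < of_int \<lfloor>b + 1/2\<rfloor>"
      by (simp_all add: floor_less_iff not_le)
    have "False" if "a < of_int p" "of_int p \<le> b" "a + 1/2 < of_int q" "of_int q \<le> b + 1/2"
      for p q :: int
    proof -
      have "of_int p < (of_int q :: real)" "of_int q < (of_int (p + 1) :: real)"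
        unfolding of_int_add of_int_1 using that \<open>b \<le> a + 1 / 2\<close> by linarith+
      then show False unfolding of_int_less_iff by simp
    qed
    from this[OF lt(1) of_int_floor_le lt(2) of_int_floor_le] show False .
  qed
  then obtain h where h: "h \<in> {0, 1/2}" "\<lfloor>b + h\<rfloor> \<le> \<lfloor>a + h\<rfloor>" by blast
  show ?thesis
  proof (cases "\<lfloor>b + h\<rfloor> < \<lfloor>a + h\<rfloor>")
    case True
    then have "class_rank v w c X h 1 T < class_rank v w c X h 1 S"
      unfolding rank by (intro floor_plus_frac_less) auto
    with h(1) show ?thesis by blast
  next
    case False
    with h(2) have eq: "\<lfloor>b + h\<rfloor> = \<lfloor>a + h\<rfloor>" by simp
    \<comment> \<open>Within one bucket, \<open>e = 1\<close> puts the smaller code on top and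
      \<open>e = -1\<close> the larger one, so one of the two signs places \<open>S\<close> above
      \<open>T\<close>.\<close>
    consider "m < m'" | "m' < m" using \<open>m \<noteq> m'\<close> by linarith
    then show ?thesis
    proof cases
      case 1
      then have "class_rank v w c X h 1 T < class_rank v w c X h 1 S"
        unfolding rank eq by (simp add: frac_less2)
      with h(1) show ?thesis by blast
    next
      case 2
      then have "class_rank v w c X h (-1) T < class_rank v w c X h (-1) S"
        unfolding rank eq by (simp add: frac_less2)
      with h(1) show ?thesis by blast
    qed
  qed
qed

definition class_min :: "('a \<Rightarrow> real) \<Rightarrow> 'a set \<Rightarrow> real" where
  "class_min v X = (if X = {} then 1 else Min (v ` X))"

lemma class_min_le: "finite X \<Longrightarrow> i \<in> X \<Longrightarrow> class_min v X \<le> v i"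
  by (auto simp: class_min_def)

lemma class_min_attained:
  assumes "finite X" "X \<noteq> {}"
  shows "\<exists>i\<in>X. v i = class_min v X"
proof -
  have "class_min v X \<in> v ` X" using assms by (simp add: class_min_def del: Min_in) (intro Min_in, auto)
  then show ?thesis by auto
qed

lemma class_min_pos:
  assumes "finite X" "\<And>i. i \<in> X \<Longrightarrow> 0 < v i"
  shows "0 < class_min v X"
  using assms by (cases "X = {}") (auto simp: class_min_def)

section \<open>Sums of least weights\<close>

lemma sum_list_take_sorted_le:
  fixes xs :: "real list"
  assumes "sorted xs" and "M \<subseteq># mset xs"
  shows "sum_list (take (size M) xs) \<le> sum_mset M"
  using assms
proof (induction xs arbitrary: M)
  case (Cons x xs)
  show ?case
  proof (cases "M = {#}")
    case False
    \<comment> \<open>Removing \<open>x\<close> whenever \<open>M\<close> contains it makes the rest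
      of \<open>M\<close> fit into \<open>xs\<close>. If \<open>M\<close> does not contain
      \<open>x\<close>, it already fits into \<open>xs\<close>, and any element of it will do. In
      both cases \<open>x \<le> y\<close>.\<close>
    define y where "y = (if x \<in># M then x else (SOME y. y \<in># M))"
    have yM: "y \<in># M" using False by (auto simp: y_def intro: someI)
    have "y \<in># mset (x # xs)" using yM Cons.prems(2) by (meson mset_subset_eqD)
    then have "x \<le> y" using Cons.prems(1) by auto
    have sub: "M - {#y#} \<subseteq># mset xs"
    proof (cases "x \<in># M")
      case True
      then show ?thesis using Cons.prems(2) by (simp add: y_def subset_eq_diff_conv)
    next
      case False
      have "count M a \<le> count (mset xs) a" for a
        using False mset_subset_eq_count[OF Cons.prems(2), of a]
        by (cases "a = x") (auto simp: not_in_iff)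
      then have "M \<subseteq># mset xs" by (simp add: subseteq_mset_def)
      then show ?thesis by (meson diff_subset_eq_self subset_mset.order_trans)
    qed
    have "sum_list (take (size (M - {#y#})) xs) \<le> sum_mset (M - {#y#})"
      using Cons.IH[OF _ sub] Cons.prems(1) by simp
    moreover have M: "M = add_mset y (M - {#y#})" using yM by simp
    then have "size M = Suc (size (M - {#y#}))" by (metis size_add_mset)
    moreover have "sum_mset M = y + sum_mset (M - {#y#})" using M by (metis sum_mset.add_mset)
    ultimately show ?thesis using \<open>x \<le> y\<close> by simp
  qed simp
qed simp

text \<open>A subset \<open>Z\<close> of exactly \<open>nat \<lfloor>r\<rfloor>\<close> indices
  already weighs at least as much as the least coordinates; the remaining indices of
  \<open>Y\<close> add positive weights.\<close>

lemma least_sum_le_sum: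
  assumes Y: "Y \<subseteq> {1..n}" and r: "nat \<lfloor>r\<rfloor> \<le> card Y" and v: "\<forall>i\<in>{1..n}. 0 < v i"
  shows "least_sum n v r \<le> (\<Sum>i\<in>Y. v i)"
proof -
  obtain Z where Z: "Z \<subseteq> Y" "card Z = nat \<lfloor>r\<rfloor>" "finite Z"
    using obtain_subset_with_card_n[OF r] by blast
  have "mset_set Z \<subseteq># mset_set {1..n}"
    using Z Y by (intro subset_imp_msubset_mset_set) auto
  then have "image_mset v (mset_set Z) \<subseteq># image_mset v (mset_set {1..n})"
    by (rule image_mset_subseteq_mono)
  also have "\<dots> = mset (sort (map v [1..<n+1]))"
    by (simp only: mset_sort mset_map mset_upt Suc_eq_plus1[symmetric]
        atLeastLessThanSuc_atLeastAtMost)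
  finally have "sum_list (take (size (image_mset v (mset_set Z))) (sort (map v [1..<n+1])))
      \<le> sum_mset (image_mset v (mset_set Z))"
    by (intro sum_list_take_sorted_le) auto
  then have "least_sum n v r \<le> (\<Sum>i\<in>Z. v i)"
    by (simp add: least_sum_def Z(2) sum_unfold_sum_mset)
  also have "\<dots> \<le> (\<Sum>i\<in>Y. v i)"
    using Z(1) Y v by (intro sum_mono2) (auto intro: finite_subset less_imp_le)
  finally show ?thesis .
qed

section \<open>Families of colourings\<close>

text \<open>Greedy choice: some point lies in at least half of the sets not yet hit, so each chosen
  point at least halves their number. Fewer than \<open>2 ^ M\<close> sets are exhausted after
  \<open>M\<close> points.\<close>

lemma exists_small_hitting_set:
  assumes "finite \<Omega>" "\<Omega> \<noteq> {}" and "finite \<G>" "card \<G> < 2 ^ M"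
    and "\<And>G. G \<in> \<G> \<Longrightarrow> 2 * card (\<Omega> - G) \<le> card \<Omega>"
  shows "\<exists>W\<subseteq>\<Omega>. card W \<le> M \<and> (\<forall>G\<in>\<G>. W \<inter> G \<noteq> {})"
  using assms(3-)
proof (induction M arbitrary: \<G>)
  case 0
  then show ?case by (intro exI[of _ "{}"]) auto
next
  case (Suc M)
  have "\<exists>\<omega>\<in>\<Omega>. 2 * card {G\<in>\<G>. \<omega> \<notin> G} \<le> card \<G>"
  proof (rule ccontr)
    assume "\<not> ?thesis"
    \<comment> \<open>Double counting of the pairs of a point and a set missing it: every point
      would be missed by more than half of the sets, while every set misses at most half of the
      points.\<close>
    then have "(\<Sum>\<omega>\<in>\<Omega>. card \<G>) < (\<Sum>\<omega>\<in>\<Omega>. 2 * card {G\<in>\<G>. \<omega> \<notin> G})"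
      using assms(1,2) by (intro sum_strict_mono) (auto simp: not_le)
    also have "\<dots> = 2 * (\<Sum>G\<in>\<G>. card {\<omega>\<in>\<Omega>. \<omega> \<notin> G})"
      using sum_multicount_gen[OF assms(1) Suc.prems(1), of "\<lambda>\<omega> G. \<omega> \<notin> G"
          "\<lambda>G. card {\<omega>\<in>\<Omega>. \<omega> \<notin> G}"]
      by (simp add: sum_distrib_left[symmetric])
    also have "\<dots> = (\<Sum>G\<in>\<G>. 2 * card (\<Omega> - G))"
      by (simp add: sum_distrib_left set_diff_eq)
    also have "\<dots> \<le> (\<Sum>G\<in>\<G>. card \<Omega>)"
      using Suc.prems(3) by (intro sum_mono) auto
    finally show False by (simp add: mult.commute)
  qed
  then obtain \<omega> where \<omega>: "\<omega> \<in> \<Omega>" "2 * card {G\<in>\<G>. \<omega> \<notin> G} \<le> card \<G>" by blast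
  obtain W where W: "W \<subseteq> \<Omega>" "card W \<le> M" "\<forall>G\<in>{G\<in>\<G>. \<omega> \<notin> G}. W \<inter> G \<noteq> {}"
    using Suc.IH[of "{G\<in>\<G>. \<omega> \<notin> G}"] Suc.prems \<omega>(2) by auto
  have "card (insert \<omega> W) \<le> Suc M"
    using W(2) finite_subset[OF W(1) assms(1)] by (simp add: card_insert_if)
  with W \<omega>(1) show ?case by (intro exI[of _ "insert \<omega> W"]) auto
qed

section \<open>Collisions in uniformly random colourings, as counts\<close>

abbreviation colourings :: "'a set \<Rightarrow> nat \<Rightarrow> ('a \<Rightarrow> nat) set" where
  "colourings V q \<equiv> Pi\<^sub>E V (\<lambda>_. {..<q})"

text \<open>Two elements collide with probability at most \<open>1 / q\<close>: in a collision the
  colour of \<open>x\<close> can be read off from \<open>y\<close>, so such a colouring is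
  determined by its restriction to \<open>V - {x}\<close>.\<close>

lemma card_colourings_collision_le:
  assumes V: "finite V" and xy: "x \<in> V" "y \<in> V" "x \<noteq> y"
  shows "q * card {\<kappa> \<in> colourings V q. \<kappa> x = \<kappa> y} \<le> card (colourings V q)"
proof -
  let ?C = "{\<kappa> \<in> colourings V q. \<kappa> x = \<kappa> y}"
  have "inj_on (\<lambda>\<kappa>. restrict \<kappa> (V - {x})) ?C"
  proof (rule inj_onI)
    fix \<kappa> \<psi> assume *: "\<kappa> \<in> ?C" "\<psi> \<in> ?C" "restrict \<kappa> (V - {x}) = restrict \<psi> (V - {x})"
    have eq: "\<kappa> z = \<psi> z" if "z \<in> V" "z \<noteq> x" for z
      using fun_cong[OF *(3), of z] that by simp
    show "\<kappa> = \<psi>"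
    proof (rule PiE_ext[of _ V "\<lambda>_. {..<q}"])
      fix z assume "z \<in> V"
      then show "\<kappa> z = \<psi> z" using eq[of z] eq[of y] * xy by (cases "z = x") auto
    qed (use * in auto)
  qed
  then have "card ?C \<le> card (colourings (V - {x}) q)"
    using V by (intro card_inj_on_le[of "\<lambda>\<kappa>. restrict \<kappa> (V - {x})"]) (auto simp: PiE_iff extensional_def split: if_splits intro: finite_PiE)
  also have "\<dots> = q ^ (card V - 1)" using V xy by (simp add: card_PiE)
  finally have "q * card ?C \<le> q * q ^ (card V - 1)" by simp
  also have "\<dots> = q ^ card V" using V xy by (auto simp: power_eq_if[of _ "card V"] card_eq_0_iff)
  also have "\<dots> = card (colourings V q)" using V by (simp add: card_PiE)
  finally show ?thesis .
qed

text \<open>Union bound over the possible collisions of \<open>p\<close> with an element of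
  \<open>S\<close>.\<close>

lemma card_colourings_not_isolating_le:
  assumes V: "finite V" and p: "p \<in> V" and S: "S \<subseteq> V - {p}"
  shows "q * card ((colourings V q) - {\<kappa>. \<kappa> p \<notin> \<kappa> ` S}) \<le> card S * card (colourings V q)"
proof -
  have fin: "finite (colourings V q)" "finite S" using V S by (auto intro: finite_PiE finite_subset)
  have "(colourings V q) - {\<kappa>. \<kappa> p \<notin> \<kappa> ` S} = (\<Union>x\<in>S. {\<kappa> \<in> colourings V q. \<kappa> p = \<kappa> x})"
    by auto
  then have "q * card ((colourings V q) - {\<kappa>. \<kappa> p \<notin> \<kappa> ` S})
      \<le> q * (\<Sum>x\<in>S. card {\<kappa> \<in> colourings V q. \<kappa> p = \<kappa> x})"
    using card_UN_le[OF fin(2), of "\<lambda>x. {\<kappa> \<in> colourings V q. \<kappa> p = \<kappa> x}"] by simp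
  also have "\<dots> \<le> (\<Sum>x\<in>S. card (colourings V q))"
    unfolding sum_distrib_left using V p S by (intro sum_mono card_colourings_collision_le) auto
  finally show ?thesis by simp
qed

lemma card_less_pairs:
  fixes S :: "'a::linorder set"
  assumes "finite S"
  shows "2 * card {(x, y) \<in> S \<times> S. x < y} = card S * (card S - 1)"
proof -
  let ?L = "{(x, y) \<in> S \<times> S. x < y}"
  have fin: "finite ?L" using assms by (auto intro: finite_subset[of _ "S \<times> S"])
  have "S \<times> S = ?L \<union> prod.swap ` ?L \<union> (\<lambda>x. (x, x)) ` S"
    by (auto simp: image_iff not_less_iff_gr_or_eq) 
  then have "card S * card S = card (?L \<union> prod.swap ` ?L \<union> (\<lambda>x. (x, x)) ` S)"
    by (metis card_cartesian_product)
  also have "\<dots> = card (?L \<union> prod.swap ` ?L) + card ((\<lambda>x. (x, x)) ` S)"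
    using fin assms by (intro card_Un_disjoint) auto
  also have "card (?L \<union> prod.swap ` ?L) = card ?L + card (prod.swap ` ?L)"
    using fin assms by (intro card_Un_disjoint) auto
  also have "card (prod.swap ` ?L) = card ?L" by (intro card_image) auto
  also have "card ((\<lambda>x. (x, x)) ` S) = card S" by (intro card_image) (auto intro: inj_onI)
  finally show ?thesis by (simp add: diff_mult_distrib2)
qed

text \<open>Discard every element that has a smaller one of the same colour. The rest have distinct
  colours, and each discarded element is the larger member of a collision.\<close>

lemma card_le_card_image_plus_collisions:
  fixes S :: "'a::linorder set"
  assumes "finite S"
  shows "card S \<le> card (f ` S) + card {(x, y) \<in> S \<times> S. x < y \<and> f x = f y}"
proof -
  let ?R = "{y \<in> S. \<exists>x\<in>S. x < y \<and> f x = f y}"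
  have "inj_on f (S - ?R)"
    by (rule inj_onI) (auto dest: sym, (metis linorder_neqE)+)
  then have "card (S - ?R) = card (f ` (S - ?R))" by (simp add: card_image)
  also have "\<dots> \<le> card (f ` S)" using assms by (intro card_mono) auto
  finally have "card (S - ?R) \<le> card (f ` S)" .
  moreover have "?R = snd ` {(x, y) \<in> S \<times> S. x < y \<and> f x = f y}" by force
  then have "card ?R \<le> card {(x, y) \<in> S \<times> S. x < y \<and> f x = f y}"
    using assms by (simp only:) (intro card_image_le, auto intro: finite_subset[of _ "S \<times> S"])
  moreover have "card S = card (S - ?R) + card ?R"
    using assms by (subst card_Un_disjoint[symmetric]) (auto intro: arg_cong[of _ _ card])
  ultimately show ?thesis by linarith
qed

text \<open>Markov's inequality for the number of pairs of \<open>S\<close> with equal colours.\<close>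

lemma card_colourings_few_colours_le:
  fixes V :: "'a::linorder set"
  assumes V: "finite V" and S: "S \<subseteq> V" "r \<le> card S"
  shows "2 * q * (card S + 1 - r) * card ((colourings V q) - {\<kappa>. r \<le> card (\<kappa> ` S)})
    \<le> card S * (card S - 1) * card (colourings V q)"
proof -
  let ?\<Omega> = "colourings V q"
  let ?L = "{(x, y) \<in> S \<times> S. x < y}"
  have fin: "finite ?\<Omega>" "finite S" "finite ?L"
    using V S by (auto intro: finite_PiE finite_subset[of _ V] finite_subset[of _ "V \<times> V"])
  have "(card S + 1 - r) * card (?\<Omega> - {\<kappa>. r \<le> card (\<kappa> ` S)})
      = (\<Sum>\<kappa>\<in>?\<Omega> - {\<kappa>. r \<le> card (\<kappa> ` S)}. card S + 1 - r)"
    by simp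
  \<comment> \<open>With at most \<open>r - 1\<close> colours on \<open>S\<close>, at least
    \<open>card S - (r - 1)\<close> pairs collide.\<close>
  also have "\<dots> \<le> (\<Sum>\<kappa>\<in>?\<Omega> - {\<kappa>. r \<le> card (\<kappa> ` S)}. card {z\<in>?L. \<kappa> (fst z) = \<kappa> (snd z)})"
  proof (rule sum_mono)
    fix \<kappa> assume "\<kappa> \<in> ?\<Omega> - {\<kappa>. r \<le> card (\<kappa> ` S)}"
    moreover have "{(x, y) \<in> S \<times> S. x < y \<and> \<kappa> x = \<kappa> y} = {z\<in>?L. \<kappa> (fst z) = \<kappa> (snd z)}" by auto
    ultimately show "card S + 1 - r \<le> card {z\<in>?L. \<kappa> (fst z) = \<kappa> (snd z)}"
      using card_le_card_image_plus_collisions[OF fin(2), of \<kappa>] by auto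
  qed
  also have "\<dots> \<le> (\<Sum>\<kappa>\<in>?\<Omega>. card {z\<in>?L. \<kappa> (fst z) = \<kappa> (snd z)})"
    using fin by (intro sum_mono2) auto
  also have "\<dots> = (\<Sum>z\<in>?L. card {\<kappa>\<in>?\<Omega>. \<kappa> (fst z) = \<kappa> (snd z)})"
    using fin by (intro sum_multicount_gen) auto
  finally have "q * ((card S + 1 - r) * card (?\<Omega> - {\<kappa>. r \<le> card (\<kappa> ` S)}))
      \<le> (\<Sum>z\<in>?L. q * card {\<kappa>\<in>?\<Omega>. \<kappa> (fst z) = \<kappa> (snd z)})"
    by (simp add: sum_distrib_left[symmetric])
  also have "\<dots> \<le> (\<Sum>z\<in>?L. card ?\<Omega>)"
    using V S by (intro sum_mono card_colourings_collision_le) auto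
  also have "\<dots> = card ?L * card ?\<Omega>" by simp
  finally have "2 * (q * ((card S + 1 - r) * card (?\<Omega> - {\<kappa>. r \<le> card (\<kappa> ` S)}))) \<le> (2 * card ?L) * card ?\<Omega>"
    by simp
  then show ?thesis unfolding card_less_pairs[OF fin(2)] by (simp add: mult.assoc)
qed

text \<open>The two inequalities for \<open>q\<close> make each requirement fail with probability at
  most 1/2: by the union bound for isolation, by Markov's inequality for many colours. Isolation
  passes to smaller sets and many colours to larger ones, so it suffices to treat sets of sizes
  exactly \<open>s - 1\<close> and \<open>s\<close>. That leaves at most \<open>2 * n ^ s\<close>
  requirements, which the greedy choice meets.\<close>

lemma exists_colourings:
  fixes n q r s M :: nat
  assumes "1 \<le> r" "r \<le> s" "s \<le> n" "2 * (s - 1) \<le> q" "s * (s - 1) \<le> q * (s + 1 - r)" "1 \<le> q"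
    and M: "2 * n ^ s < 2 ^ M"
  shows "\<exists>W\<subseteq>colourings {1..n} q. card W \<le> M
    \<and> (\<forall>p\<in>{1..n}. \<forall>S\<subseteq>{1..n} - {p}. card S < s \<longrightarrow> (\<exists>\<kappa>\<in>W. \<kappa> p \<notin> \<kappa> ` S))
    \<and> (\<forall>S\<subseteq>{1..n}. s \<le> card S \<longrightarrow> (\<exists>\<kappa>\<in>W. r \<le> card (\<kappa> ` S)))"
proof -
  define \<Omega> where "\<Omega> = colourings {1..n} q"
  define \<P> where "\<P> = {1..n} \<times> {S. S \<subseteq> {1..n} \<and> card S = s - 1}"
  define \<Q> where "\<Q> = {S. S \<subseteq> {1..n} \<and> card S = s}"
  define \<A> where "\<A> = (\<lambda>(p, S). {\<kappa> :: nat \<Rightarrow> nat. \<kappa> p \<notin> \<kappa> ` S}) ` {(p, S) \<in> \<P>. p \<notin> S}"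
  define \<B> where "\<B> = (\<lambda>S. {\<kappa> :: nat \<Rightarrow> nat. r \<le> card (\<kappa> ` S)}) ` \<Q>"
  have \<Omega>: "finite \<Omega>" "\<Omega> \<noteq> {}"
    using \<open>1 \<le> q\<close> by (auto simp: \<Omega>_def PiE_eq_empty_iff lessThan_empty_iff intro!: finite_PiE)
  have fin: "finite \<P>" "finite \<Q>" by (auto simp: \<P>_def \<Q>_def)
  then have fin': "finite {(p, S) \<in> \<P>. p \<notin> S}" by (auto intro: finite_subset[of _ \<P>])
  have "card \<A> \<le> card \<P>"
    unfolding \<A>_def using fin fin' by (intro order_trans[OF card_image_le] card_mono) auto
  also have "\<dots> = n * (n choose (s - 1))"
    by (simp add: \<P>_def card_cartesian_product n_subsets)
  also have "\<dots> \<le> n * n ^ (s - 1)"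
    using assms by (intro mult_left_mono binomial_le_pow) auto
  also have "\<dots> = n ^ s" using assms by (simp add: power_eq_if)
  finally have "card \<A> \<le> n ^ s" .
  moreover have "card \<B> \<le> n ^ s"
    unfolding \<B>_def using fin assms
    by (intro order_trans[OF card_image_le] order_trans[OF _ binomial_le_pow]) (auto simp: \<Q>_def n_subsets)
  ultimately have card: "card (\<A> \<union> \<B>) < 2 ^ M"
    using card_Un_le[of \<A> \<B>] M by linarith
  have half: "2 * card (\<Omega> - G) \<le> card \<Omega>" if "G \<in> \<A> \<union> \<B>" for G
    using that
  proof
    assume "G \<in> \<A>"
    then obtain p S where G: "G = {\<kappa>. \<kappa> p \<notin> \<kappa> ` S}" and pS: "p \<in> {1..n}" "S \<subseteq> {1..n} - {p}" "card S = s - 1"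
      by (auto simp: \<A>_def \<P>_def)
    have "q * (2 * card (\<Omega> - G)) \<le> 2 * (card S * card \<Omega>)"
      using card_colourings_not_isolating_le[OF _ pS(1,2), of q] by (simp add: G \<Omega>_def)
    also have "\<dots> = 2 * (s - 1) * card \<Omega>" using pS(3) by simp
    also have "\<dots> \<le> q * card \<Omega>" using assms(4) by (intro mult_right_mono) auto
    finally show ?thesis using \<open>1 \<le> q\<close> by simp
  next
    assume "G \<in> \<B>"
    then obtain S where G: "G = {\<kappa>. r \<le> card (\<kappa> ` S)}" and S: "S \<subseteq> {1..n}" "card S = s"
      by (auto simp: \<B>_def \<Q>_def)
    have "q * (s + 1 - r) * (2 * card (\<Omega> - G)) \<le> s * (s - 1) * card \<Omega>"
      using card_colourings_few_colours_le[OF _ S(1), of r q] S(2) assms(2) by (simp add: G \<Omega>_def mult_ac)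
    also have "\<dots> \<le> q * (s + 1 - r) * card \<Omega>" using assms(5) by (intro mult_right_mono) auto
    finally show ?thesis using assms by simp
  qed
  obtain W where W: "W \<subseteq> \<Omega>" "card W \<le> M" "\<And>G. G \<in> \<A> \<union> \<B> \<Longrightarrow> W \<inter> G \<noteq> {}"
    using exists_small_hitting_set[OF \<Omega> _ card half] fin fin' by (auto simp: \<A>_def \<B>_def)
  show ?thesis
  proof (intro exI[of _ W] conjI ballI allI impI)
    fix p S assume p: "p \<in> {1..n}" and S: "S \<subseteq> {1..n} - {p}" "card S < s"
    have "card S \<le> s - 1" "s - 1 \<le> card ({1..n} - {p})" using S(2) p assms(3) by auto
    then obtain T where T: "S \<subseteq> T" "T \<subseteq> {1..n} - {p}" "card T = s - 1"
      using exists_subset_between S(1) by (metis finite_Diff finite_atLeastAtMost)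
    have "{\<kappa>. \<kappa> p \<notin> \<kappa> ` T} \<in> \<A>" unfolding \<A>_def \<P>_def using T p by force
    then show "\<exists>\<kappa>\<in>W. \<kappa> p \<notin> \<kappa> ` S" using W(3) T(1) by blast
  next
    fix S assume S: "S \<subseteq> {1..n}" "s \<le> card S"
    obtain T where T: "T \<subseteq> S" "card T = s" using obtain_subset_with_card_n[OF S(2)] by blast
    have "{\<kappa> :: nat \<Rightarrow> nat. r \<le> card (\<kappa> ` T)} \<in> \<B>" unfolding \<B>_def \<Q>_def using T S by auto
    then obtain \<kappa> where "\<kappa> \<in> W" "r \<le> card (\<kappa> ` T)" using W(3) by blast
    moreover have "card (\<kappa> ` T) \<le> card (\<kappa> ` S)"
      using T(1) S(1) by (intro card_mono image_mono) (auto intro: finite_subset)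
    ultimately show "\<exists>\<kappa>\<in>W. r \<le> card (\<kappa> ` S)" by (auto intro: order_trans)
  qed (use W in \<open>auto simp: \<Omega>_def\<close>)
qed

section \<open>Good classes\<close>

text \<open>A colour class is bad if \<open>S\<close> and \<open>T\<close> differ on it and \<open>T\<close> exceeds \<open>S\<close> there by more than
  half the least weight. If all the classes on which \<open>S\<close> and \<open>T\<close> differ are bad, then the sum of
  their least weights is below \<open>2 * (l - k)\<close>, so there are fewer than \<open>nat \<lfloor>r\<rfloor>\<close> of them.\<close>

lemma exists_good_class:
  assumes v: "\<forall>i\<in>{1..n}. 0 < v i"
    and r: "2 * (l - k) \<le> least_sum n v r" "1 \<le> nat \<lfloor>r\<rfloor>"
    and W: "W \<subseteq> colourings {1..n} q"
    and iso: "\<And>p A. p \<in> {1..n} \<Longrightarrow> A \<subseteq> {1..n} - {p} \<Longrightarrow> card A < s \<Longrightarrow> \<exists>\<kappa>\<in>W. \<kappa> p \<notin> \<kappa> ` A"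
    and many: "\<And>A. A \<subseteq> {1..n} \<Longrightarrow> s \<le> card A \<Longrightarrow> \<exists>\<kappa>\<in>W. nat \<lfloor>r\<rfloor> \<le> card (\<kappa> ` A)"
    and S: "S \<in> mset_layers n v k l" and T: "T \<in> mset_layers n v k l" and ST: "\<not> S \<subseteq># T"
  shows "\<exists>\<kappa>\<in>W. \<exists>j<q. (\<exists>i\<in>{i\<in>{1..n}. \<kappa> i = j}. count S i \<noteq> count T i)
    \<and> (\<Sum>i | i \<in> {1..n} \<and> \<kappa> i = j. real (count T i) * v i)
      \<le> (\<Sum>i | i \<in> {1..n} \<and> \<kappa> i = j. real (count S i) * v i)
        + class_min v {i\<in>{1..n}. \<kappa> i = j} / 2"
proof -
  define D where "D = {i\<in>{1..n}. count S i \<noteq> count T i}"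
  obtain p where p: "count T p < count S p"
    using ST by (auto simp: subseteq_mset_def not_le)
  then have "p \<in># S" by (simp flip: count_greater_zero_iff)
  with S have p1: "p \<in> {1..n}" by (auto simp: mset_layers_def)
  have D: "finite D" "D \<subseteq> {1..n}" "p \<in> D" using p p1 by (auto simp: D_def)
  show ?thesis
  proof (cases "card D < s")
    case True
    \<comment> \<open>Once \<open>p\<close> is isolated from the rest of \<open>D\<close>, it is the
      only element of its class where \<open>S\<close> and \<open>T\<close> differ, and there
      \<open>T\<close> has the smaller multiplicity.\<close>
    have "card (D - {p}) < s" using D True by (simp add: card_Diff_singleton)
    then obtain \<kappa> where \<kappa>: "\<kappa> \<in> W" "\<kappa> p \<notin> \<kappa> ` (D - {p})"
      using iso[OF p1, of "D - {p}"] D by blast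
    let ?X = "{i\<in>{1..n}. \<kappa> i = \<kappa> p}"
    have "count T i \<le> count S i" if "i \<in> ?X" for i
    proof -
      have "i \<notin> D - {p}" using that \<kappa>(2) by (metis (mono_tags, lifting) imageI mem_Collect_eq)
      then show ?thesis using that p by (auto simp: D_def)
    qed
    then have "(\<Sum>i\<in>?X. real (count T i) * v i) \<le> (\<Sum>i\<in>?X. real (count S i) * v i)"
      using v by (intro sum_mono mult_right_mono) (auto intro: less_imp_le)
    moreover have "0 < class_min v ?X" using v by (intro class_min_pos) auto
    moreover have "\<kappa> p < q" using W \<kappa>(1) p1 by (auto simp: PiE_iff)
    ultimately show ?thesis using \<kappa>(1) p p1 by (intro bexI[of _ \<kappa>] exI[of _ "\<kappa> p"]) auto
  next
    case False
    then obtain \<kappa> where \<kappa>: "\<kappa> \<in> W" "nat \<lfloor>r\<rfloor> \<le> card (\<kappa> ` D)"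
      using many[of D] D by auto
    define X where "X j = {i\<in>{1..n}. \<kappa> i = j}" for j
    define d where "d j = (\<Sum>i\<in>X j. real (count T i) * v i) - (\<Sum>i\<in>X j. real (count S i) * v i)" for j
    have \<kappa>q: "\<kappa> ` {1..n} \<subseteq> {..<q}" using W \<kappa>(1) by (auto simp: PiE_iff)
    have X: "finite (X j)" "X j \<noteq> {}" if "j \<in> \<kappa> ` D" for j using that D(2) unfolding X_def by (simp, blast)
    show ?thesis
    proof (rule ccontr)
      assume neg: "\<not> ?thesis"
      have bad: "class_min v (X j) / 2 < d j" if "j \<in> \<kappa> ` D" for j
      proof (rule ccontr)
        assume "\<not> ?thesis"
        then have "(\<Sum>i\<in>X j. real (count T i) * v i)
            \<le> (\<Sum>i\<in>X j. real (count S i) * v i) + class_min v (X j) / 2"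
          by (simp add: d_def)
        moreover have "j < q" "\<exists>i\<in>X j. count S i \<noteq> count T i"
          using that \<kappa>q D(2) by (auto simp: X_def D_def)
        ultimately show False using neg \<kappa>(1) unfolding X_def by blast
      qed
      \<comment> \<open>Classes that miss \<open>D\<close> contribute nothing, so the excesses over
        the colours of \<open>D\<close> add up to the whole difference of the sizes, which is at
        most \<open>l - k\<close>.\<close>
      have "d j = 0" if "j \<in> {..<q} - \<kappa> ` D" for j
        using that unfolding d_def X_def D_def by (auto intro!: sum.cong)
      then have "(\<Sum>j\<in>\<kappa> ` D. d j) = (\<Sum>j<q. d j)"
        using \<kappa>q D(2) by (intro sum.mono_neutral_left) auto
      also have "\<dots> = wsize n v T - wsize n v S"
        unfolding d_def X_def wsize_def sum_subtractf
        by (simp only: sum.group[OF finite_atLeastAtMost finite_lessThan \<kappa>q])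
      also have "\<dots> \<le> l - k" using S T by (auto simp: mset_layers_def)
      finally have "(\<Sum>j\<in>\<kappa> ` D. d j) \<le> l - k" .
      moreover have "(\<Sum>j\<in>\<kappa> ` D. class_min v (X j) / 2) < (\<Sum>j\<in>\<kappa> ` D. d j)"
        using bad D by (intro sum_strict_mono) auto
      ultimately have less: "(\<Sum>j\<in>\<kappa> ` D. class_min v (X j)) < 2 * (l - k)"
        by (simp add: sum_divide_distrib[symmetric])
      \<comment> \<open>A lightest element from each class meeting \<open>D\<close> gives at least
        \<open>nat \<lfloor>r\<rfloor>\<close> distinct indices, since \<open>\<kappa>\<close>
        recovers the class. Their total weight is below \<open>2 * (l - k)\<close>, contrary to the
        choice of \<open>r\<close>.\<close>
      have "\<forall>j\<in>\<kappa> ` D. \<exists>i\<in>X j. v i = class_min v (X j)"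
        using X by (blast intro: class_min_attained)
      then obtain y where y: "\<And>j. j \<in> \<kappa> ` D \<Longrightarrow> y j \<in> X j \<and> v (y j) = class_min v (X j)"
        by metis
      have inj: "inj_on y (\<kappa> ` D)"
        using y by (intro inj_on_inverseI[of _ \<kappa>]) (auto simp: X_def)
      have "least_sum n v r \<le> (\<Sum>i\<in>y ` \<kappa> ` D. v i)"
        using y \<kappa>(2) v card_image[OF inj] by (intro least_sum_le_sum) (auto simp: X_def)
      also have "\<dots> = (\<Sum>j\<in>\<kappa> ` D. class_min v (X j))"
        using y by (simp add: sum.reindex[OF inj])
      finally show False using less r(1) by linarith
    qed
  qed
qed

text \<open>Each colour class of each colouring contributes four maps, from two shifts and two
  signs; a good class always exists, and one of its maps reverses the given pair.\<close>

lemma poset_dim_mset_layers_le_colourings: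
  assumes v: "\<forall>i\<in>{1..n}. 0 < v i"
    and r: "2 * (l - k) \<le> least_sum n v r" "1 \<le> nat \<lfloor>r\<rfloor>"
    and W: "W \<subseteq> colourings {1..n} q" "card W \<le> M"
    and iso: "\<And>p A. p \<in> {1..n} \<Longrightarrow> A \<subseteq> {1..n} - {p} \<Longrightarrow> card A < s \<Longrightarrow> \<exists>\<kappa>\<in>W. \<kappa> p \<notin> \<kappa> ` A"
    and many: "\<And>A. A \<subseteq> {1..n} \<Longrightarrow> s \<le> card A \<Longrightarrow> \<exists>\<kappa>\<in>W. nat \<lfloor>r\<rfloor> \<le> card (\<kappa> ` A)"
  shows "poset_dim (mset_layers n v k l) (mset_layers_order n v k l) \<le> 4 * q * M"
proof -
  let ?A = "mset_layers n v k l"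
  define X where "X \<kappa> j = {i\<in>{1..n}. \<kappa> i = j}" for \<kappa> :: "nat \<Rightarrow> nat" and j
  have X: "finite (X \<kappa> j)" "X \<kappa> j \<subseteq> {1..n}" for \<kappa> j by (auto simp: X_def)
  have fin: "finite ((\<lambda>(S, Y). filter_mset (\<lambda>i. i \<in> Y) S) ` (?A \<times> Pow {1..n}))"
    using finite_mset_layers[OF v] by auto
  \<comment> \<open>One numbering serves all classes, because only finitely many restrictions of
    multisets occur.\<close>
  obtain c :: "nat multiset \<Rightarrow> nat"
    where c: "inj_on c ((\<lambda>(S, Y). filter_mset (\<lambda>i. i \<in> Y) S) ` (?A \<times> Pow {1..n}))"
    using finite_imp_inj_to_nat_seg[OF fin] by (elim exE conjE) (rule that)
  define F where "F = (\<lambda>(\<kappa>, j, h, e). class_rank v (class_min v (X \<kappa> j)) c (X \<kappa> j) h e)"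
  define I where "I = W \<times> {..<q} \<times> {0, 1/2 :: real} \<times> {1, -1 :: real}"
  have pos: "0 < class_min v (X \<kappa> j)" for \<kappa> j
    using v X by (intro class_min_pos) blast+
  show ?thesis
  proof (rule poset_dim_le_card[where F = F and I = I])
    have "finite W" using W(1) by (rule finite_subset) (auto intro: finite_PiE)
    then show "finite I" by (simp add: I_def)
    have "card I = 4 * q * card W" by (simp add: I_def card_cartesian_product)
    then show "card I \<le> 4 * q * M" using W(2) by simp
  next
    fix i S T assume "i \<in> I" "(S, T) \<in> mset_layers_order n v k l"
    then show "F i S \<le> F i T"
      unfolding F_def I_def mset_layers_order_def relation_of_def
      using pos class_min_le[OF X(1)] by (auto intro!: class_rank_mono X)
  next
    fix S T assume S: "S \<in> ?A" and T: "T \<in> ?A" and "(S, T) \<notin> mset_layers_order n v k l"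
    then have "\<not> S \<subseteq># T" by (auto simp: mset_layers_order_def relation_of_def)
    from exists_good_class[OF v r W(1) iso many S T this]
    obtain \<kappa> j where \<kappa>: "\<kappa> \<in> W" "j < q" and diff: "\<exists>i\<in>X \<kappa> j. count S i \<noteq> count T i"
      and le: "(\<Sum>i\<in>X \<kappa> j. real (count T i) * v i)
        \<le> (\<Sum>i\<in>X \<kappa> j. real (count S i) * v i) + class_min v (X \<kappa> j) / 2"
      unfolding X_def by blast
    have "inj_on c {filter_mset (\<lambda>i. i \<in> X \<kappa> j) S, filter_mset (\<lambda>i. i \<in> X \<kappa> j) T}"
      using S T X(2) by (intro inj_on_subset[OF c]) force
    from class_rank_separates[OF pos diff this le]
    obtain h e where he: "h \<in> {0, 1/2}" "e \<in> {1, -1}"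
      and "class_rank v (class_min v (X \<kappa> j)) c (X \<kappa> j) h e T
        < class_rank v (class_min v (X \<kappa> j)) c (X \<kappa> j) h e S"
      by (elim bexE)
    then have "F (\<kappa>, j, h, e) T < F (\<kappa>, j, h, e) S" by (simp add: F_def)
    moreover have "(\<kappa>, j, h, e) \<in> I" unfolding I_def using \<kappa> he by (intro SigmaI) simp_all
    ultimately show "\<exists>i\<in>I. F i T < F i S" by (rule bexI)
  qed (rule partial_order_on_mset_layers)
qed

text \<open>The \<open>n\<close> multiplicities are themselves an embedding. This bound settles all
  cases in which \<open>n\<close> is at most the claimed bound.\<close>

lemma poset_dim_mset_layers_le:
  "poset_dim (mset_layers n v k l) (mset_layers_order n v k l) \<le> n"
proof (rule poset_dim_le_card[where F = "\<lambda>i S. count S i" and I = "{1..n}"])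
  fix S T assume S: "S \<in> mset_layers n v k l" "T \<in> mset_layers n v k l"
    and "(S, T) \<notin> mset_layers_order n v k l"
  then obtain i where i: "count T i < count S i"
    by (auto simp: mset_layers_order_def relation_of_def subseteq_mset_def not_le)
  then have "i \<in># S" by (simp flip: count_greater_zero_iff)
  with i S show "\<exists>i\<in>{1..n}. count T i < count S i" by (auto simp: mset_layers_def)
next
  fix i S T assume "(S, T) \<in> mset_layers_order n v k l"
  then show "count S i \<le> count T i"
    by (simp add: mset_layers_order_def relation_of_def mset_subset_eq_count)
qed (simp_all add: partial_order_on_mset_layers)

text \<open>For \<open>n = 1\<close> the claimed bound is 0. Here \<open>l - k\<close> is at most
  half of the only weight, so at most one multiplicity fits between \<open>k\<close> and
  \<open>l\<close>.\<close>

lemma poset_dim_mset_layers_one: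
  assumes v: "0 < v 1" and r: "2 * (l - k) \<le> least_sum 1 v r" "1 \<le> r"
  shows "poset_dim (mset_layers 1 v k l) (mset_layers_order 1 v k l) = 0"
proof -
  have "least_sum 1 v r = v 1"
  proof -
    have "1 \<le> nat \<lfloor>r\<rfloor>" using r(2) by linarith
    then show ?thesis by (simp add: least_sum_def)
  qed
  then have v1: "2 * (l - k) \<le> v 1" using r by simp
  have "poset_dim (mset_layers 1 v k l) (mset_layers_order 1 v k l) \<le> 0"
  proof (rule poset_dim_le_card[where F = "\<lambda>_ _. 0 :: nat" and I = "{} :: nat set"])
    fix S T assume S: "S \<in> mset_layers 1 v k l" and T: "T \<in> mset_layers 1 v k l"
      and "(S, T) \<notin> mset_layers_order 1 v k l"
    then obtain i where i: "count T i < count S i"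
      by (auto simp: mset_layers_order_def relation_of_def subseteq_mset_def not_le)
    then have "i \<in># S" by (simp flip: count_greater_zero_iff)
    with S have "i = 1" by (auto simp: mset_layers_def)
    with i have "(real (count T 1) + 1) * v 1 \<le> real (count S 1) * v 1"
      using v by (intro mult_right_mono) auto
    moreover have "real (count S 1) * v 1 \<le> l" "k \<le> real (count T 1) * v 1"
      using S T by (auto simp: mset_layers_def wsize_def)
    ultimately show "\<exists>i\<in>{}. (0 :: nat) < 0"
      using v v1 by (simp add: distrib_right)
  qed (auto intro: partial_order_on_mset_layers)
  then show ?thesis by simp
qed

section \<open>Numerical estimates\<close>

lemma ln_2_ge: "69 / 100 \<le> ln (2 :: real)"
  using ln_approx_bounds[of 2 2] by (simp add: eval_nat_numeral)

lemma ln_ge_of_two_power_le: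
  fixes x :: real
  assumes "2 ^ m \<le> x"
  shows "real m * (69 / 100) \<le> ln x"
proof -
  have "real m * (69 / 100) \<le> real m * ln 2" using ln_2_ge by (intro mult_left_mono) auto
  also have "\<dots> = ln (2 ^ m)" by (simp add: ln_realpow)
  also have "\<dots> \<le> ln x" using assms by (subst ln_le_cancel_iff) (auto intro: less_le_trans[of _ "2 ^ m"])
  finally show ?thesis .
qed

text \<open>Bootstrapping: a lower bound on \<open>ln x\<close> gives, through
  \<open>43 * ln x < x\<close>, a larger power of 2 below \<open>x\<close> and hence a better bound.
  The exponents run through 1, 4, 6, 7.\<close>

lemma ln_ge_of_linear_bound:
  fixes x :: real
  assumes "2 \<le> x" and "43 * ln x < x"
  shows "14 / 3 \<le> ln x"
proof -
  have "69 / 100 \<le> ln x" using ln_ge_of_two_power_le[of 1 x] assms by simp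
  then have "2 ^ 4 \<le> x" using assms(2) by simp
  then have "276 / 100 \<le> ln x" using ln_ge_of_two_power_le[of 4 x] by simp
  then have "2 ^ 6 \<le> x" using assms(2) by simp
  then have "414 / 100 \<le> ln x" using ln_ge_of_two_power_le[of 6 x] by simp
  then have "2 ^ 7 \<le> x" using assms(2) by simp
  then show ?thesis using ln_ge_of_two_power_le[of 7 x] by simp
qed

text \<open>Up to rounding, \<open>s = a * R\<close> forces \<open>q = a^2 / (a - 1) * R\<close> in
  the last inequality. The cost is proportional to \<open>q * s\<close>, and
  \<open>a^3 / (a - 1)\<close> is least at \<open>a = 3/2\<close>, which gives
  \<open>q = 9 * R / 2\<close>.\<close>

lemma colouring_parameters:
  fixes R :: nat
  assumes "1 \<le> R"
  defines "s \<equiv> 3 * R div 2" and "q \<equiv> 9 * R div 2"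
  shows "R \<le> s" "2 * (s - 1) \<le> q" "s * (s - 1) \<le> q * (s + 1 - R)"
proof -
  show "R \<le> s" "2 * (s - 1) \<le> q" using assms by simp_all
  consider u where "R = 2 * u" "1 \<le> u" | u where "R = 2 * u + 1"
    using assms(1) by (cases "even R") (auto elim!: evenE oddE)
  then show "s * (s - 1) \<le> q * (s + 1 - R)"
  proof cases
    case 1
    then have "s * (s - 1) = 3 * u * (3 * u - 1)" "q * (s + 1 - R) = 9 * u * (u + 1)"
      by (simp_all add: s_def q_def)
    moreover have "3 * u * (3 * u - 1) \<le> 3 * u * (3 * (u + 1))" by (intro mult_left_mono) auto
    moreover have "3 * u * (3 * (u + 1)) = 9 * u * (u + 1)" by (simp add: algebra_simps)
    ultimately show ?thesis by (simp only:)
  next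
    case (2 u)
    have "s = 3 * u + 1" "q = 9 * u + 4" by (simp_all add: s_def q_def 2)
    then have "s * (s - 1) = (3 * u + 1) * (3 * u)" "q * (s + 1 - R) = (9 * u + 4) * (u + 1)"
      by (simp_all add: 2)
    then show ?thesis by (simp add: algebra_simps)
  qed
qed

text \<open>The main term has coefficient 2700/69, about 39.1. The remaining 267/69 of the 43
  absorbs \<open>36 * R\<close>, which comes from the 2 added to \<open>m\<close>; this takes
  \<open>R * L \<ge> 28/3\<close>, hence \<open>R \<ge> 2\<close>. For \<open>R = 1\<close> the
  rounded values 4 and 1 of the parameters are small enough.\<close>

lemma colouring_count_bound:
  fixes R :: nat and L m :: real
  assumes R: "1 \<le> R" and L: "14 / 3 \<le> L" and m: "0 \<le> m" "m \<le> real (3 * R div 2) * (L / (69 / 100))"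
  shows "4 * real (9 * R div 2) * (m + 2) \<le> 43 * (real R)\<^sup>2 * L"
proof (cases "R = 1")
  case True
  then show ?thesis using assms by simp
next
  case False
  have "real (9 * R div 2) \<le> 9 * real R / 2" "real (3 * R div 2) \<le> 3 * real R / 2"
    by linarith+
  moreover from this(2) have "m \<le> 3 * real R / 2 * (L / (69 / 100))"
    using L by (intro order_trans[OF m(2)] mult_right_mono) auto
  ultimately have "4 * real (9 * R div 2) * (m + 2)
      \<le> 4 * (9 * real R / 2) * (3 * real R / 2 * (L / (69 / 100)) + 2)"
    using m(1) by (intro mult_mono add_mono) simp_all
  also have "\<dots> = 2700 / 69 * ((real R)\<^sup>2 * L) + 36 * real R"
    by (simp add: power2_eq_square algebra_simps)
  also have "36 * real R \<le> 267 / 69 * ((real R)\<^sup>2 * L)"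
  proof -
    have "2 * (14 / 3) \<le> real R * L" using False R L by (intro mult_mono) auto
    then have "36 \<le> 267 / 69 * (real R * L)" by simp
    then have "36 * real R \<le> 267 / 69 * (real R * L) * real R" by (rule mult_right_mono) simp
    also have "\<dots> = 267 / 69 * ((real R)\<^sup>2 * L)" by (simp add: power2_eq_square)
    finally show ?thesis .
  qed
  finally show ?thesis by (simp add: algebra_simps)
qed

section \<open>Choice of the parameters and conclusion\<close>

theorem theorem1p8:
  fixes k l r :: real and n :: nat and v :: "nat \<Rightarrow> real"
  assumes "0 \<le> k" and "k < l"
    and "n > 0"
    and "\<forall>i\<in>{1..n}. 0 < v i"
    and "least_sum n v r \<ge> 2 * (l - k)" and "r \<ge> 1"
    and "\<forall>s. least_sum n v s \<ge> 2 * (l - k) \<and> s \<ge> 1 \<longrightarrow> r \<le> s"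
  shows "real (poset_dim (mset_layers n v k l) (mset_layers_order n v k l)) \<le> 43 * r\<^sup>2 * ln (real n)"
proof (cases "real n \<le> 43 * r\<^sup>2 * ln (real n)")
  case True
  then show ?thesis using poset_dim_mset_layers_le[of n v k l] by linarith
next
  case large: False
  show ?thesis
  proof (cases "n = 1")
    case True
    then show ?thesis using poset_dim_mset_layers_one[of v l k r] assms by simp
  next
    case False
    define R where "R = nat \<lfloor>r\<rfloor>"
    define s where "s = 3 * R div 2"
    define q where "q = 9 * R div 2"
    \<comment> \<open>Then \<open>n ^ s < 2 ^ (m + 1)\<close>, so the at most
      \<open>2 * n ^ s\<close> requirements number fewer than \<open>2 ^ (m + 2)\<close>, and
      \<open>m + 2\<close> colourings suffice.\<close>
    define m where "m = nat \<lfloor>real s * log 2 (real n)\<rfloor>"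
    have n: "2 \<le> real n" using False \<open>n > 0\<close> by simp
    have R: "1 \<le> R" "real R \<le> r" using assms(6) by (auto simp: R_def le_nat_floor)
    have L0: "0 < ln (real n)" using n by simp
    have R2: "(real R)\<^sup>2 \<le> r\<^sup>2" using R by (intro power_mono) auto
    have "43 * (real R)\<^sup>2 * ln (real n) \<le> 43 * r\<^sup>2 * ln (real n)"
      using R2 L0 by (intro mult_right_mono) auto
    with large have nR: "43 * (real R)\<^sup>2 * ln (real n) < real n" by linarith
    have "1 \<le> real R" using R(1) by simp
    then have RR: "real R \<le> (real R)\<^sup>2" by (simp add: self_le_power)
    have "43 * 1 * ln (real n) \<le> 43 * (real R)\<^sup>2 * ln (real n)"
      using L0 RR \<open>1 \<le> real R\<close> by (intro mult_right_mono mult_left_mono) auto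
    with nR have "43 * ln (real n) < real n" by simp
    with n have L: "14 / 3 \<le> ln (real n)" by (rule ln_ge_of_linear_bound)
    \<comment> \<open>This ensures \<open>s \<le> n\<close>, so that sets of \<open>s\<close>
      elements exist. It holds because \<open>n\<close> exceeds the claimed bound in the present
      case.\<close>
    have "2 * real R \<le> real n"
    proof -
      have "43 * real R * 1 \<le> (43 * (real R)\<^sup>2) * ln (real n)"
        using RR L by (intro mult_mono) auto
      then show ?thesis using nR by linarith
    qed
    then have sn: "s \<le> n" unfolding s_def by linarith
    have t: "0 \<le> real s * log 2 (real n)" using n by simp
    have "real (n ^ s) = (2 powr log 2 (real n)) powr real s"
      using n by (simp add: powr_realpow)
    also have "\<dots> = 2 powr (real s * log 2 (real n))"
      by (simp only: powr_powr mult.commute)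
    also have "\<dots> < 2 powr real (m + 1)"
      using t by (simp add: m_def) linarith
    also have "\<dots> = real (2 ^ (m + 1))" by (subst powr_realpow) simp_all
    finally have "n ^ s < 2 ^ (m + 1)" by (simp only: of_nat_less_iff)
    then have M: "2 * n ^ s < 2 ^ (m + 2)" by simp
    have "1 \<le> q" using R(1) by (simp add: q_def)
    from exists_colourings[OF R(1) _ sn _ _ this M] colouring_parameters[OF R(1)]
    obtain W where W: "W \<subseteq> colourings {1..n} q" "card W \<le> m + 2"
      "\<And>p A. p \<in> {1..n} \<Longrightarrow> A \<subseteq> {1..n} - {p} \<Longrightarrow> card A < s \<Longrightarrow> \<exists>\<kappa>\<in>W. \<kappa> p \<notin> \<kappa> ` A"
      "\<And>A. A \<subseteq> {1..n} \<Longrightarrow> s \<le> card A \<Longrightarrow> \<exists>\<kappa>\<in>W. R \<le> card (\<kappa> ` A)"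
      unfolding s_def q_def by metis
    have "poset_dim (mset_layers n v k l) (mset_layers_order n v k l) \<le> 4 * q * (m + 2)"
      using assms(4,5) R(1) W unfolding R_def by (intro poset_dim_mset_layers_le_colourings)
    then have "real (poset_dim (mset_layers n v k l) (mset_layers_order n v k l))
        \<le> real (4 * q * (m + 2))"
      by (simp only: of_nat_le_iff)
    also have "\<dots> = 4 * real q * (real m + 2)" by (simp add: algebra_simps)
    also have "\<dots> \<le> 43 * (real R)\<^sup>2 * ln (real n)"
      unfolding q_def
    proof (rule colouring_count_bound[OF R(1) L])
      have "real m \<le> real s * log 2 (real n)" using t by (simp add: m_def)
      also have "\<dots> \<le> real s * (ln (real n) / (69 / 100))"
        unfolding log_def using ln_2_ge L by (intro mult_left_mono divide_left_mono) auto
      finally show "real m \<le> real (3 * R div 2) * (ln (real n) / (69 / 100))"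
        by (simp only: s_def)
    qed simp
    also have "\<dots> \<le> 43 * r\<^sup>2 * ln (real n)" by fact
    finally show ?thesis .
  qed
qed

end
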